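(* Let $z^*=(x^*,y^* )\in F$. Then $z^*$ is an $N^B$-stationary point of the problem $\min\{f(z): z\in F\}$ if and only if $$\begin{cases}\nabla_i f(z^* )=0\ \ \forall i\in\Gamma^*\setminus\{\gamma_{x^*}\}&\text{if }|\Gamma_1^*|=s\text{ and }|\Gamma_2^*|=t,\\ \nabla_i f(z^* )=0\ \ \forall i\in(\Gamma_1^*\setminus\{\gamma_{x^*}\})\cup I_2&\text{if }|\Gamma_1^*|=s\text{ and }|\Gamma_2^*|<t,\\ \nabla_i f(z^* )=0\ \ \forall i\in\{\gamma_{x^*}+1,\dots,m\}\cup\Gamma_2^*&\text{if }|\Gamma_1^*|<s\text{ and }|\Gamma_2^*|=t,\\ \nabla_i f(z^* )=0\ \ \forall i\in I\text{ with }i>\gamma_{x^*}&\text{if }|\Gamma_1^*|<s\text{ and }|\Gamma_2^*|<t.\end{cases}$$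
   Context: $l,m,n,s,t$ are positive integers with $s<m$, $t<n$; $\mathscr{A}=(a_{ijk})\in\mathbb{R}^{l\times m\times n}$ and $b\in\mathbb{R}^l$ are given. For $x\in\mathbb{R}^m$, $y\in\mathbb{R}^n$, $\mathscr{A}xy\in\mathbb{R}^l$ has entries $(\mathscr{A}xy)_i=\sum_{j,k}a_{ijk}x_jy_k$, and $f(z)=f(x,y)=\frac12\|\mathscr{A}xy-b\|^2$ for $z=(x,y)\in\mathbb{R}^{m+n}$. $I=\{1,\dots,m+n\}$, $I_1=\{1,\dots,m\}$, $I_2=\{m+1,\dots,m+n\}$; coordinates of $y$ are indexed by $I_2$. $\nabla_i f(z)$ is the $i$-th component of $\nabla f(z)$. $\Gamma^*=\{i\in I:z^*_i\neq0\}$, $\Gamma^*_1=\Gamma^*\cap I_1$, $\Gamma_2^*=\Gamma^*\cap I_2$. $\|\cdot\|_0$ counts nonzero entries. For $x\ne0$, $\gamma_x$ is the index of the first nonzero entry of $x$. $F_1=\{x\in\mathbb{R}^m:\|x\|_0\le s,\ e_{\gamma_x}^\top x=1\}$ (nonzero vectors with at most $s$ nonzero entries and first nonzero entry equal to $1$), $F_2=\{y\in\mathbb{R}^n:\|y\|_0\le t\}$, $F=F_1\times F_2$. Bouligand cones: for nonempty $S\subseteq\mathbb{R}^p$, $x\in S$, $T^B_S(x)$ is the set of $d$ for which there exist $\{x^k\}\subset S$, $x^k\to x$, and $\lambda_k\ge0$ with $\lambda_k(x^k-x)\to d$; $N^B_S(x)=\{d:\langle d,u\rangle\le0\ \forall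 u\in T^B_S(x)\}$. $z^*\in F$ is an $N^B$-stationary point if $-\nabla f(z^* )\in N^B_F(z^* )$. *)

theory Defs
  imports "HOL-Analysis.Analysis"
begin

text \<open>
  Vectors in R^m and R^n are indexed by finite linearly ordered types, so that "the first
  nonzero entry" makes sense. A point z = (x, y) of R^(m+n) is a pair (the inner product and norm
  of the product type are the Euclidean ones), and its m+n coordinates are indexed by the disjoint
  sum of the two index types: \<open>Inl j\<close> is the j-th coordinate of x, and \<open>Inr k\<close> the k-th
  coordinate of y, which is the coordinate m+k of z.
\<close>

definition coord :: "(real ^ 'm) \<times> (real ^ 'n) \<Rightarrow> 'm + 'n \<Rightarrow> real" where
  "coord z i = (case i of Inl j \<Rightarrow> fst z $ j | Inr k \<Rightarrow> snd z $ k)"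

abbreviation I1 :: "('m + 'n) set" where
  "I1 \<equiv> range Inl"

abbreviation I2 :: "('m + 'n) set" where
  "I2 \<equiv> range Inr"

text \<open>The order of \<open>{1, \<dots>, m+n}\<close>: every index of x precedes every index of y.\<close>

fun idx_less :: "'m::linorder + 'n::linorder \<Rightarrow> 'm + 'n \<Rightarrow> bool" where
  "idx_less (Inl j) (Inl j') \<longleftrightarrow> j < j'"
| "idx_less (Inl j) (Inr k) \<longleftrightarrow> True"
| "idx_less (Inr k) (Inl j) \<longleftrightarrow> False"
| "idx_less (Inr k) (Inr k') \<longleftrightarrow> k < k'"

definition supp :: "(real ^ 'm) \<times> (real ^ 'n) \<Rightarrow> ('m + 'n) set" where
  "supp z = {i. coord z i \<noteq> 0}"

definition norm0 :: "real ^ 'n \<Rightarrow> nat" where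
  "norm0 x = card {j. x $ j \<noteq> 0}"

text \<open>Meaningful only for nonzero x.\<close>

definition first_nz :: "real ^ 'm::{finite,linorder} \<Rightarrow> 'm" where
  "first_nz x = Min {j. x $ j \<noteq> 0}"

definition tensor_app :: "real ^ 'n ^ 'm ^ 'l \<Rightarrow> real ^ 'm \<Rightarrow> real ^ 'n \<Rightarrow> real ^ 'l" where
  "tensor_app A x y = (\<chi> i. \<Sum>j\<in>UNIV. \<Sum>k\<in>UNIV. A $ i $ j $ k * x $ j * y $ k)"

definition objective ::
    "real ^ 'n ^ 'm ^ 'l \<Rightarrow> real ^ 'l \<Rightarrow> (real ^ 'm) \<times> (real ^ 'n) \<Rightarrow> real" where
  "objective A b z = 1 / 2 * (norm (tensor_app A (fst z) (snd z) - b))\<^sup>2"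

definition F1 :: "nat \<Rightarrow> (real ^ 'm::{finite,linorder}) set" where
  "F1 s = {x. x \<noteq> 0 \<and> norm0 x \<le> s \<and> axis (first_nz x) 1 \<bullet> x = 1}"

definition F2 :: "nat \<Rightarrow> (real ^ 'n) set" where
  "F2 t = {y. norm0 y \<le> t}"

definition feasible :: "nat \<Rightarrow> nat \<Rightarrow> ((real ^ 'm::{finite,linorder}) \<times> (real ^ 'n)) set" where
  "feasible s t = F1 s \<times> F2 t"

text \<open>The gradient, a junk value where f is not differentiable.\<close>

definition grad :: "('a::real_inner \<Rightarrow> real) \<Rightarrow> 'a \<Rightarrow> 'a" where
  "grad f z = (THE g. GDERIV f z :> g)"

definition bouligand_tangent :: "'a::real_normed_vector set \<Rightarrow> 'a \<Rightarrow> 'a set" where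
  "bouligand_tangent S x = {d. \<exists>X c. (\<forall>k::nat. X k \<in> S) \<and> X \<longlonglongrightarrow> x \<and>
     (\<forall>k. 0 \<le> (c k :: real)) \<and> (\<lambda>k. c k *\<^sub>R (X k - x)) \<longlonglongrightarrow> d}"

definition bouligand_normal :: "'a::real_inner set \<Rightarrow> 'a \<Rightarrow> 'a set" where
  "bouligand_normal S x = {d. \<forall>u\<in>bouligand_tangent S x. d \<bullet> u \<le> 0}"

definition NB_stationary :: "('a::real_inner \<Rightarrow> real) \<Rightarrow> 'a set \<Rightarrow> 'a \<Rightarrow> bool" where
  "NB_stationary f S z \<longleftrightarrow> z \<in> S \<and> - grad f z \<in> bouligand_normal S z"

end

theory Submission imports Defs begin

text \<open>
  Write \<open>z = (x, y)\<close> and let \<open>\<gamma>\<close> be the leading index of x. The free coordinates of z are those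
  that can be varied inside the feasible set: in x, the coordinates after \<open>\<gamma>\<close>, restricted to the
  support of x if that already has s elements; in y, all coordinates, restricted to the support of
  y if that already has t elements. The theorem says that z is stationary iff the gradient vanishes
  on the free coordinates, and its four cases spell out which coordinates these are.

  Along a free coordinate the whole line through z stays feasible, hence both signs of that unit
  vector are tangent and stationarity forces the derivative to be zero
  (\<open>line_imp_bouligand_tangent\<close>). Conversely a tangent vector vanishes on every other coordinate
  (\<open>bouligand_tangent_F1_eq_0\<close>, \<open>bouligand_tangent_F2_eq_0\<close>), since that coordinate is locally
  constant on the feasible set. There are two reasons for this. The support can only grow near a
  point, so a support of maximal size is locally constant. And the normalisation makes the leading
  index locally constant: a new leading entry in front of \<open>\<gamma>\<close> would be equal to 1, but it has to be
  close to 0.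
\<close>

section \<open>Tangent cones of general sets\<close>

lemma line_imp_bouligand_tangent:
  fixes z u :: "'a::real_normed_vector"
  assumes "\<And>e. z + e *\<^sub>R u \<in> S"
  shows "u \<in> bouligand_tangent S z"
proof -
  define X where "X = (\<lambda>k. z + (1 / real (Suc k)) *\<^sub>R u)"
  have "(\<lambda>k. 1 / real (Suc k)) \<longlonglongrightarrow> 0"
    by (rule LIMSEQ_Suc) (rule lim_1_over_n)
  then have "X \<longlonglongrightarrow> z + 0 *\<^sub>R u"
    unfolding X_def by (intro tendsto_intros)
  moreover have "(\<lambda>k. real (Suc k) *\<^sub>R (X k - z)) = (\<lambda>k. u)"
    by (auto simp: X_def simp del: of_nat_Suc)
  moreover have "X k \<in> S" for k
    using assms by (simp add: X_def)
  ultimately show ?thesis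
    unfolding bouligand_tangent_def
    by (auto intro!: exI[of _ X] exI[of _ "\<lambda>k. real (Suc k)"] simp del: of_nat_Suc)
qed

lemma bouligand_tangent_Times_subset:
  "bouligand_tangent (S \<times> T) (x, y) \<subseteq> bouligand_tangent S x \<times> bouligand_tangent T y"
proof
  fix w assume "w \<in> bouligand_tangent (S \<times> T) (x, y)"
  then obtain X and c :: "nat \<Rightarrow> real" where X: "\<And>k. X k \<in> S \<times> T" "X \<longlonglongrightarrow> (x, y)"
    and c: "\<And>k. 0 \<le> c k" and lim: "(\<lambda>k. c k *\<^sub>R (X k - (x, y))) \<longlonglongrightarrow> w"
    unfolding bouligand_tangent_def by blast
  have "fst w \<in> bouligand_tangent S x"
    unfolding bouligand_tangent_def
    using X c tendsto_fst[OF X(2)] tendsto_fst[OF lim]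
    by (auto intro!: exI[of _ "\<lambda>k. fst (X k)"] exI[of _ c] simp: mem_Times_iff)
  moreover have "snd w \<in> bouligand_tangent T y"
    unfolding bouligand_tangent_def
    using X c tendsto_snd[OF X(2)] tendsto_snd[OF lim]
    by (auto intro!: exI[of _ "\<lambda>k. snd (X k)"] exI[of _ c] simp: mem_Times_iff)
  ultimately show "w \<in> bouligand_tangent S x \<times> bouligand_tangent T y"
    by (simp add: mem_Times_iff)
qed

lemma bouligand_tangent_eq_0_if_locally_constant:
  fixes x d :: "real ^ 'n"
  assumes d: "d \<in> bouligand_tangent S x"
    and const: "\<forall>\<^sub>F x' in nhds x. x' \<in> S \<longrightarrow> x' $ j = x $ j"
  shows "d $ j = 0"
proof -
  obtain X and c :: "nat \<Rightarrow> real" where X: "\<And>k. X k \<in> S" "X \<longlonglongrightarrow> x"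
    and lim: "(\<lambda>k. c k *\<^sub>R (X k - x)) \<longlonglongrightarrow> d"
    using d unfolding bouligand_tangent_def by blast
  have "\<forall>\<^sub>F k in sequentially. X k \<in> S \<longrightarrow> X k $ j = x $ j"
    using const X(2) by (rule eventually_compose_filterlim)
  then have "\<forall>\<^sub>F k in sequentially. (c k *\<^sub>R (X k - x)) $ j = 0"
    by (rule eventually_mono) (simp add: X(1))
  then have "(\<lambda>k. (c k *\<^sub>R (X k - x)) $ j) \<longlonglongrightarrow> 0"
    by (rule tendsto_eventually)
  with tendsto_vec_nth[OF lim, of j] show ?thesis
    by (rule LIMSEQ_unique)
qed

section \<open>Sparsity\<close>

lemma eventually_support_grows:
  fixes x :: "real ^ 'n"
  shows "\<forall>\<^sub>F x' in nhds x. {j. x $ j \<noteq> 0} \<subseteq> {j. x' $ j \<noteq> 0}"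
proof -
  have "\<forall>\<^sub>F x' in nhds x. \<forall>j \<in> {j. x $ j \<noteq> 0}. x' $ j \<noteq> 0"
  proof (rule eventually_ball_finite)
    show "\<forall>j \<in> {j. x $ j \<noteq> 0}. \<forall>\<^sub>F x' in nhds x. x' $ j \<noteq> 0"
      by (auto intro!: tendsto_imp_eventually_ne tendsto_vec_nth filterlim_ident)
  qed simp
  then show ?thesis
    by (rule eventually_mono) auto
qed

text \<open>
  The support of a nearby vector contains that of x, which has the maximal size s already; if the
  nearby vector is s-sparse too, the two supports agree.
\<close>

lemma eventually_zero_stays_zero:
  fixes x :: "real ^ 'n"
  assumes "norm0 x = s" "x $ j = 0"
  shows "\<forall>\<^sub>F x' in nhds x. norm0 x' \<le> s \<longrightarrow> x' $ j = x $ j"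
  using eventually_support_grows[of x]
proof (rule eventually_mono)
  fix x' :: "real ^ 'n"
  assume sub: "{j. x $ j \<noteq> 0} \<subseteq> {j. x' $ j \<noteq> 0}"
  show "norm0 x' \<le> s \<longrightarrow> x' $ j = x $ j"
  proof
    assume "norm0 x' \<le> s"
    then have "{j. x $ j \<noteq> 0} = {j. x' $ j \<noteq> 0}"
      using assms(1) by (intro card_seteq sub) (auto simp: norm0_def)
    with assms(2) show "x' $ j = x $ j" by auto
  qed
qed

lemma norm0_add_axis_le:
  fixes x :: "real ^ 'n"
  assumes "norm0 x \<le> s" and "x $ i \<noteq> 0 \<or> norm0 x < s"
  shows "norm0 (x + e *\<^sub>R axis i 1) \<le> s"
proof -
  have "norm0 (x + e *\<^sub>R axis i 1) \<le> card (insert i {j. x $ j \<noteq> 0})"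
    unfolding norm0_def by (rule card_mono) (auto simp: axis_def)
  also have "\<dots> \<le> s"
    using assms by (auto simp: norm0_def card_insert_if)
  finally show ?thesis .
qed

lemma bouligand_tangent_F2_eq_0:
  assumes "v \<in> bouligand_tangent (F2 t) y" "norm0 y = t" "y $ k = 0"
  shows "v $ k = 0"
  using assms(1)
  by (rule bouligand_tangent_eq_0_if_locally_constant)
    (use eventually_zero_stays_zero[OF assms(2,3)] in \<open>simp add: F2_def\<close>)

section \<open>Normalisation of the leading entry\<close>

lemma first_nz_eqI:
  assumes "x $ g \<noteq> 0" and "\<And>j. j < g \<Longrightarrow> x $ j = 0"
  shows "first_nz x = g"
  unfolding first_nz_def using assms by (intro Min_eqI) (auto simp: not_less[symmetric])

lemma nth_less_first_nz:
  assumes "j < first_nz x"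
  shows "x $ j = 0"
proof (rule ccontr)
  assume "x $ j \<noteq> 0"
  then have "first_nz x \<le> j"
    unfolding first_nz_def by (intro Min_le) auto
  with assms show False by simp
qed

lemma F1_iff: "x \<in> F1 s \<longleftrightarrow> norm0 x \<le> s \<and> x $ first_nz x = 1"
  by (auto simp: F1_def inner_axis')

text \<open>
  An earlier leading index would need an entry equal to 1 at a position where x is 0, and a later
  one a vanishing entry where x is 1. Neither is possible close to x.
\<close>

lemma eventually_first_nz_eq:
  fixes x :: "real ^ 'm::{finite,linorder}"
  assumes "x \<in> F1 s"
  shows "\<forall>\<^sub>F x' in nhds x. x' \<in> F1 s \<longrightarrow> first_nz x' = first_nz x"
proof -
  have "\<forall>\<^sub>F x' in nhds x. \<forall>j \<in> {..<first_nz x}. x' $ j < 1"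
  proof (rule eventually_ball_finite)
    show "\<forall>j \<in> {..<first_nz x}. \<forall>\<^sub>F x' in nhds x. x' $ j < 1"
    proof
      fix j assume "j \<in> {..<first_nz x}"
      then have "x $ j < 1" by (simp add: nth_less_first_nz)
      moreover have "((\<lambda>x'. x' $ j) \<longlongrightarrow> x $ j) (nhds x)"
        by (intro tendsto_vec_nth filterlim_ident)
      ultimately show "\<forall>\<^sub>F x' in nhds x. x' $ j < 1"
        by (intro order_tendstoD)
    qed
  qed simp
  with eventually_support_grows[of x] show ?thesis
  proof eventually_elim
    case (elim x')
    show ?case
    proof
      assume "x' \<in> F1 s"
      then have one: "x' $ first_nz x' = 1" by (simp add: F1_iff)
      have "x $ first_nz x \<noteq> 0"
        using assms by (simp add: F1_iff)
      then have "x' $ first_nz x \<noteq> 0"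
        using elim(1) by blast
      then have "\<not> first_nz x < first_nz x'"
        using nth_less_first_nz by blast
      moreover have "\<not> first_nz x' < first_nz x"
        using elim(2) one by force
      ultimately show "first_nz x' = first_nz x" by simp
    qed
  qed
qed

lemma bouligand_tangent_F1_eq_0:
  fixes x u :: "real ^ 'm::{finite,linorder}"
  assumes x: "x \<in> F1 s" and u: "u \<in> bouligand_tangent (F1 s) x"
    and j: "j \<le> first_nz x \<or> norm0 x = s \<and> x $ j = 0"
  shows "u $ j = 0"
  using u
proof (rule bouligand_tangent_eq_0_if_locally_constant)
  show "\<forall>\<^sub>F x' in nhds x. x' \<in> F1 s \<longrightarrow> x' $ j = x $ j"
    using j
  proof
    assume j: "j \<le> first_nz x"
    from eventually_first_nz_eq[OF x] show ?thesis
    proof (rule eventually_mono, intro impI)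
      fix x' assume "x' \<in> F1 s \<longrightarrow> first_nz x' = first_nz x" and "x' \<in> F1 s"
      with j x show "x' $ j = x $ j"
        by (cases "j = first_nz x") (auto simp: F1_iff nth_less_first_nz)
    qed
  next
    assume "norm0 x = s \<and> x $ j = 0"
    then have "\<forall>\<^sub>F x' in nhds x. norm0 x' \<le> s \<longrightarrow> x' $ j = x $ j"
      by (intro eventually_zero_stays_zero) auto
    then show ?thesis
      by (rule eventually_mono) (simp add: F1_iff)
  qed
qed

lemma F1_add_axis:
  fixes x :: "real ^ 'm::{finite,linorder}"
  assumes x: "x \<in> F1 s" and j: "first_nz x < j" and free: "x $ j \<noteq> 0 \<or> norm0 x < s"
  shows "x + e *\<^sub>R axis j 1 \<in> F1 s"
proof -
  let ?x = "x + e *\<^sub>R axis j 1"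
  have same: "?x $ i = x $ i" if "i \<le> first_nz x" for i
    using that j by (auto simp: axis_def)
  have one: "?x $ first_nz x = 1"
    unfolding same[OF order_refl] using x by (simp add: F1_iff)
  have "first_nz ?x = first_nz x"
  proof (rule first_nz_eqI)
    show "?x $ first_nz x \<noteq> 0"
      unfolding one by simp
    show "?x $ i = 0" if "i < first_nz x" for i
      unfolding same[OF less_imp_le[OF that]] using that by (rule nth_less_first_nz)
  qed
  moreover have "norm0 ?x \<le> s"
    using x free by (intro norm0_add_axis_le) (auto simp: F1_iff)
  ultimately show ?thesis
    using one by (simp only: F1_iff simp_thms)
qed

section \<open>Stationarity\<close>

lemma NB_stationary_imp_orthogonal_line:
  assumes st: "NB_stationary f S z" and line: "\<And>e. z + e *\<^sub>R u \<in> S"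
  shows "grad f z \<bullet> u = 0"
proof -
  have "z + e *\<^sub>R (- u) \<in> S" for e
    using line[of "- e"] by simp
  then have "u \<in> bouligand_tangent S z" "- u \<in> bouligand_tangent S z"
    using line by (auto intro: line_imp_bouligand_tangent)
  with st have "- grad f z \<bullet> u \<le> 0" "- grad f z \<bullet> (- u) \<le> 0"
    unfolding NB_stationary_def bouligand_normal_def by blast+
  then show ?thesis by simp
qed

lemma NB_stationary_feasible_iff:
  fixes f :: "(real ^ 'm::{finite,linorder}) \<times> (real ^ 'n::finite) \<Rightarrow> real"
  assumes z: "(x, y) \<in> feasible s t"
  shows "NB_stationary f (feasible s t) (x, y) \<longleftrightarrow>
    (\<forall>j. first_nz x < j \<and> (x $ j \<noteq> 0 \<or> norm0 x < s) \<longrightarrow> fst (grad f (x, y)) $ j = 0) \<and>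
    (\<forall>k. y $ k \<noteq> 0 \<or> norm0 y < t \<longrightarrow> snd (grad f (x, y)) $ k = 0)"
    (is "_ \<longleftrightarrow> (\<forall>j. ?J j \<longrightarrow> fst ?g $ j = 0) \<and> (\<forall>k. ?K k \<longrightarrow> snd ?g $ k = 0)")
proof -
  have x: "x \<in> F1 s" and y: "y \<in> F2 t"
    using z by (auto simp: feasible_def)
  show ?thesis
  proof (intro iffI conjI allI impI)
    fix j assume st: "NB_stationary f (feasible s t) (x, y)" and "?J j"
    then have "(x, y) + e *\<^sub>R (axis j 1, 0) \<in> feasible s t" for e
      using x y by (simp add: feasible_def F1_add_axis)
    from NB_stationary_imp_orthogonal_line[OF st this] show "fst ?g $ j = 0"
      by (simp add: inner_prod_def inner_axis)
  next
    fix k assume st: "NB_stationary f (feasible s t) (x, y)" and "?K k"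
    then have "(x, y) + e *\<^sub>R (0, axis k 1) \<in> feasible s t" for e
      using x y by (auto simp: feasible_def F2_def intro!: norm0_add_axis_le)
    from NB_stationary_imp_orthogonal_line[OF st this] show "snd ?g $ k = 0"
      by (simp add: inner_prod_def inner_axis)
  next
    assume *: "(\<forall>j. ?J j \<longrightarrow> fst ?g $ j = 0) \<and> (\<forall>k. ?K k \<longrightarrow> snd ?g $ k = 0)"
    have "?g \<bullet> w = 0" if w: "w \<in> bouligand_tangent (feasible s t) (x, y)" for w
    proof -
      have u: "fst w \<in> bouligand_tangent (F1 s) x" and v: "snd w \<in> bouligand_tangent (F2 t) y"
        using w bouligand_tangent_Times_subset unfolding feasible_def by (force simp: mem_Times_iff)+
      have "fst ?g $ j * fst w $ j = 0" for j
        using * bouligand_tangent_F1_eq_0[OF x u, of j] x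
        by (cases "?J j") (auto simp: F1_iff not_less)
      moreover have "snd ?g $ k * snd w $ k = 0" for k
        using * bouligand_tangent_F2_eq_0[OF v, of k] y
        by (cases "?K k") (auto simp: F2_def not_less)
      ultimately show ?thesis
        by (simp only: inner_prod_def inner_vec_def inner_real_def sum.neutral_const add_0_left)
    qed
    then show "NB_stationary f (feasible s t) (x, y)"
      using z by (simp add: NB_stationary_def bouligand_normal_def)
  qed
qed

theorem theorem3p3:
  fixes A :: "real ^ 'n::{finite,linorder} ^ 'm::{finite,linorder} ^ 'l::finite"
    and b :: "real ^ 'l::finite"
    and x :: "real ^ 'm::{finite,linorder}" and y :: "real ^ 'n::{finite,linorder}"
    and s t :: nat
  assumes "0 < s" and "s < CARD('m)"
    and "0 < t" and "t < CARD('n)"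
    and "(x, y) \<in> feasible s t"
  shows "NB_stationary (objective A b) (feasible s t) (x, y) \<longleftrightarrow>
    (let D = coord (grad (objective A b) (x, y));
         \<Gamma> = supp (x, y); \<Gamma>\<^sub>1 = \<Gamma> \<inter> I1; \<Gamma>\<^sub>2 = \<Gamma> \<inter> I2;
         \<gamma> = first_nz x
     in (card \<Gamma>\<^sub>1 = s \<and> card \<Gamma>\<^sub>2 = t \<longrightarrow> (\<forall>i \<in> \<Gamma> - {Inl \<gamma>}. D i = 0)) \<and>
        (card \<Gamma>\<^sub>1 = s \<and> card \<Gamma>\<^sub>2 < t \<longrightarrow> (\<forall>i \<in> (\<Gamma>\<^sub>1 - {Inl \<gamma>}) \<union> I2. D i = 0)) \<and>
        (card \<Gamma>\<^sub>1 < s \<and> card \<Gamma>\<^sub>2 = t \<longrightarrow> (\<forall>i \<in> Inl ` {\<gamma><..} \<union> \<Gamma>\<^sub>2. D i = 0)) \<and>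
        (card \<Gamma>\<^sub>1 < s \<and> card \<Gamma>\<^sub>2 < t \<longrightarrow> (\<forall>i. idx_less (Inl \<gamma>) i \<longrightarrow> D i = 0)))"
proof -
  have \<Gamma>\<^sub>1: "supp (x, y) \<inter> I1 = Inl ` {j. x $ j \<noteq> 0}"
    and \<Gamma>\<^sub>2: "supp (x, y) \<inter> I2 = Inr ` {k. y $ k \<noteq> 0}"
    by (auto simp: supp_def coord_def)
  have card: "card (supp (x, y) \<inter> I1) = norm0 x" "card (supp (x, y) \<inter> I2) = norm0 y"
    unfolding \<Gamma>\<^sub>1 \<Gamma>\<^sub>2 norm0_def by (simp_all add: card_image)
  have supp: "Inl j \<in> supp (x, y) \<longleftrightarrow> x $ j \<noteq> 0" "Inr k \<in> supp (x, y) \<longleftrightarrow> y $ k \<noteq> 0" for j k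
    by (auto simp: supp_def coord_def)
  have coord: "coord w (Inl j) = fst w $ j" "coord w (Inr k) = snd w $ k"
    for w :: "(real ^ 'm::{finite,linorder}) \<times> (real ^ 'n::{finite,linorder})" and j k
    by (auto simp: coord_def)
  have le: "norm0 x \<le> s" "norm0 y \<le> t"
    using assms(5) by (auto simp: feasible_def F1_iff F2_def)
  have after: "first_nz x < j \<longleftrightarrow> j \<noteq> first_nz x" if "x $ j \<noteq> 0" for j
    using that nth_less_first_nz[of j x] by (meson neqE order.strict_implies_not_eq)
  show ?thesis
    unfolding NB_stationary_feasible_iff[OF assms(5)] Let_def card
    using le after
    by (cases "norm0 x = s"; cases "norm0 y = t")
      (auto simp: Ball_def split_sum_all supp coord image_iff)
qed

end
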